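(* Let $f:\mathbb{R}^n\to\mathbb{R}\cup\{\infty\}$ be a proper, lower semicontinuous, convex function with $\mathrm{dom}\,f$ unbounded, and let $C\subset\mathbb{R}^n$ be a nonempty closed convex set such that $C\cap\mathrm{dom}\,f$ is unbounded. Assume $\inf_{x\in C}f(x)>-\infty$ and $$0\notin\partial(f+\delta_C)(\infty).$$ Then $\inf_{x\in C}f(x)$ is attained, i.e., there exists $x^*\in C\cap\mathrm{dom}\,f$ with $f(x^* )=\inf_{x\in C}f(x)$.
   Context: $\delta_C(x)=0$ if $x\in C$ and $\infty$ otherwise. For $\varphi:\mathbb{R}^n\to\mathbb{R}\cup\{\infty\}$: $\mathrm{dom}\,\varphi=\{x\mid\varphi(x)<\infty\}$; $\varphi$ is proper if $\mathrm{dom}\,\varphi\ne\emptyset$; $\mathrm{epi}\,\varphi=\{(x,r)\in\mathbb{R}^n\times\mathbb{R}\mid r\ge\varphi(x)\}$. For $\varphi$ proper, lower semicontinuous, convex with $\mathrm{dom}\,\varphi$ unbounded, and $I=\{1,\dots,n\}$ selecting the $x$-coordinates in $\mathbb{R}^n\times\mathbb{R}$: $T(\infty_I;\mathrm{epi}\,\varphi)$ is the set of $(w,\rho)$ such that for all sequences $(x_k,r_k)\in\mathrm{epi}\,\varphi$ with $\|x_k\|\to\infty$ and all $t_k>0$ with $t_k\to0$ there exist $(w_k,\rho_k)\to(w,\rho)$ with $(x_k,r_k)+t_k(w_k,\rho_k)\in\mathrm{epi}\,\varphi$ for all $k$. $N(\infty_I;\mathrm{epi}\,\varphi)=\{(u,c)\mid\langle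 u,w\rangle+c\rho\le0\ \forall(w,\rho)\in T(\infty_I;\mathrm{epi}\,\varphi)\}$, and $\partial\varphi(\infty)=\{u\mid(u,-1)\in N(\infty_I;\mathrm{epi}\,\varphi)\}$. *)

theory Defs
  imports "HOL-Analysis.Analysis"
begin

text \<open>
  Functions into the reals extended by infinity are modelled as functions into \<^typ>\<open>ereal\<close>
  that never take the value minus infinity; that restriction is a separate hypothesis wherever
  it is needed.
\<close>

definition eff_dom :: "('a \<Rightarrow> ereal) \<Rightarrow> 'a set" where
  "eff_dom \<phi> = {x. \<phi> x < \<infinity>}"

definition proper :: "('a \<Rightarrow> ereal) \<Rightarrow> bool" where
  "proper \<phi> \<longleftrightarrow> eff_dom \<phi> \<noteq> {}"

definition epi :: "('a \<Rightarrow> ereal) \<Rightarrow> ('a \<times> real) set" where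
  "epi \<phi> = {(x, r). ereal r \<ge> \<phi> x}"

definition lower_semicontinuous :: "('a::topological_space \<Rightarrow> ereal) \<Rightarrow> bool" where
  "lower_semicontinuous \<phi> \<longleftrightarrow> (\<forall>x. \<phi> x \<le> Liminf (at x) \<phi>)"

text \<open>The library's \<^const>\<open>convex_on\<close> only covers real-valued functions.\<close>

definition econvex :: "('a::real_vector \<Rightarrow> ereal) \<Rightarrow> bool" where
  "econvex \<phi> \<longleftrightarrow> (\<forall>x y t. 0 < t \<and> t < 1 \<longrightarrow>
     \<phi> ((1 - t) *\<^sub>R x + t *\<^sub>R y) \<le> ereal (1 - t) * \<phi> x + ereal t * \<phi> y)"

definition delta :: "'a set \<Rightarrow> 'a \<Rightarrow> ereal" where
  "delta C x = (if x \<in> C then 0 else \<infinity>)"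

text \<open>
  In the cones at infinity, only the first component of the points of \<open>S\<close> is required
  to escape to infinity (the index set \<open>I\<close> selects the \<open>x\<close>-coordinates).
\<close>

definition tangent_cone_inf ::
    "('a::real_normed_vector \<times> real) set \<Rightarrow> ('a \<times> real) set" where
  "tangent_cone_inf S = {(w, \<rho>).
     \<forall>(x :: nat \<Rightarrow> 'a) (r :: nat \<Rightarrow> real) (t :: nat \<Rightarrow> real).
       (\<forall>k. (x k, r k) \<in> S) \<longrightarrow> filterlim (\<lambda>k. norm (x k)) at_top sequentially \<longrightarrow>
       (\<forall>k. t k > 0) \<longrightarrow> t \<longlonglongrightarrow> 0 \<longrightarrow>
       (\<exists>(w' :: nat \<Rightarrow> 'a) (\<rho>' :: nat \<Rightarrow> real).
          (\<lambda>k. (w' k, \<rho>' k)) \<longlonglongrightarrow> (w, \<rho>) \<and>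
          (\<forall>k. (x k, r k) + t k *\<^sub>R (w' k, \<rho>' k) \<in> S))}"

definition normal_cone_inf :: "('a::real_inner \<times> real) set \<Rightarrow> ('a \<times> real) set" where
  "normal_cone_inf S = {(u, c). \<forall>(w, \<rho>) \<in> tangent_cone_inf S. u \<bullet> w + c * \<rho> \<le> 0}"

definition subdiff_inf :: "('a::real_inner \<Rightarrow> ereal) \<Rightarrow> 'a set" where
  "subdiff_inf \<phi> = {u. (u, -1) \<in> normal_cone_inf (epi \<phi>)}"

end

theory Submission
  imports Defs
begin

text \<open>
  If the infimum \<open>m\<close> is not attained, lower semicontinuity and compactness make every set
  \<open>{x \<in> C. f x \<le> m + \<epsilon>}\<close> unbounded. Hence there are points \<open>(x\<^sub>k, r\<^sub>k)\<close> of the epigraph of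
  \<open>f + \<delta>\<^sub>C\<close> that escape to infinity with \<open>r\<^sub>k = m + 1 / (k + 1)\<^sup>2\<close>. Moving from them along a
  tangent \<open>(w, \<rho>)\<close> at infinity with the longer steps \<open>t\<^sub>k = 1 / (k + 1)\<close> stays in the epigraph, so
  never gets below height \<open>m\<close>; this forces \<open>\<rho> \<ge> 0\<close>, that is, \<open>0\<close> is a subgradient at infinity.
\<close>

lemma lower_semicontinuous_open_superlevel:
  assumes "lower_semicontinuous \<phi>"
  shows "open {x. c < \<phi> x}"
proof (subst open_subopen, safe)
  fix l assume l: "c < \<phi> l"
  with assms have "c < Liminf (at l) \<phi>"
    by (auto simp: lower_semicontinuous_def intro: less_le_trans)
  then have "eventually (\<lambda>x. c < \<phi> x) (at l)"
    by (rule less_LiminfD)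
  \<comment> \<open>The filter \<open>at l\<close> leaves out \<open>l\<close> itself; the fact
    \<open>l\<close> supplies the missing point.\<close>
  with l have "eventually (\<lambda>x. c < \<phi> x) (nhds l)"
    by (auto simp: eventually_at_filter elim: eventually_mono)
  then show "\<exists>T. open T \<and> l \<in> T \<and> T \<subseteq> {x. c < \<phi> x}"
    by (auto simp: eventually_nhds)
qed

text \<open>Sublevel sets within \<open>C\<close> at levels above the infimum are closed, and any
  finitely many of them meet the compact one at level \<open>a\<close> in a common point. By
  compactness all of them share a point, whose value is then at most every level above the
  infimum.\<close>

lemma inf_attained_if_bounded_sublevel:
  fixes \<phi> :: "'a::heine_borel \<Rightarrow> ereal"
  assumes lsc: "lower_semicontinuous \<phi>" and "closed C"
    and less: "(INF x\<in>C. \<phi> x) < a"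
    and bdd: "bounded {x \<in> C. \<phi> x \<le> a}"
  shows "\<exists>x\<in>C. \<phi> x = (INF y\<in>C. \<phi> y)"
proof -
  define m where "m = (INF x\<in>C. \<phi> x)"
  define S where "S c = {x \<in> C. \<phi> x \<le> c}" for c
  have closed: "closed (S c)" for c
  proof -
    have "S c = C - {x. c < \<phi> x}"
      by (auto simp: S_def)
    then show ?thesis
      using \<open>closed C\<close> lower_semicontinuous_open_superlevel[OF lsc] by (simp add: closed_Diff)
  qed
  have compact: "compact (S a)"
    using bdd closed[of a] by (simp add: S_def compact_eq_bounded_closed)
  have "S a \<inter> (\<Inter>c\<in>{m<..}. S c) \<noteq> {}"
  proof (rule compact_imp_fip_image[OF compact closed])
    fix I assume I: "finite I" "I \<subseteq> {m<..}"
    \<comment> \<open>A point of value below the smallest level lies in all the chosen sets at once.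
      Inserting \<open>a\<close> puts it into \<open>S a\<close> and covers the case of empty
      \<open>I\<close>.\<close>
    define c where "c = Min (insert a I)"
    have "m < c"
      using I less by (auto simp: c_def m_def)
    then obtain x where x: "x \<in> C" "\<phi> x < c"
      by (auto simp: m_def INF_less_iff)
    then have "\<phi> x \<le> b" if "b \<in> insert a I" for b
      using I(1) that by (auto simp: c_def intro: less_imp_le)
    then show "S a \<inter> (\<Inter>c\<in>I. S c) \<noteq> {}"
      using x by (auto simp: S_def)
  qed
  then obtain x where x: "x \<in> C" and le: "\<And>c. m < c \<Longrightarrow> \<phi> x \<le> c"
    by (auto simp: S_def)
  have "\<phi> x = m"
  proof (rule antisym)
    show "\<phi> x \<le> m"
      using le by (rule dense_ge)
    show "m \<le> \<phi> x"
      unfolding m_def using x by (rule INF_lower)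
  qed
  with x show ?thesis
    by (auto simp: m_def)
qed

lemma zero_in_subdiff_infI:
  fixes \<phi> :: "'a::real_inner \<Rightarrow> ereal"
  assumes lower: "\<And>x. ereal m \<le> \<phi> x"
    and unbdd: "\<And>\<epsilon>. 0 < \<epsilon> \<Longrightarrow> \<not> bounded {x. \<phi> x \<le> ereal (m + \<epsilon>)}"
  shows "0 \<in> subdiff_inf \<phi>"
proof -
  define t where "t k = inverse (real (Suc k))" for k
  \<comment> \<open>The excess height is the square of the step: after division by the step it
    leaves only \<open>t k\<close>, which still tends to 0.\<close>
  define r where "r k = m + (t k)\<^sup>2" for k
  have t_pos: "0 < t k" for k
    by (simp add: t_def)
  have t_lim: "t \<longlonglongrightarrow> 0"
    unfolding t_def by (rule LIMSEQ_inverse_real_of_nat)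
  have "\<exists>x. real k < norm x \<and> \<phi> x \<le> ereal (r k)" for k
    using unbdd[of "(t k)\<^sup>2"] t_pos[of k]
    by (force simp: r_def bounded_iff not_le)
  then obtain x where x: "\<And>k. real k < norm (x k)" "\<And>k. \<phi> (x k) \<le> ereal (r k)"
    by metis
  have x_lim: "filterlim (\<lambda>k. norm (x k)) at_top sequentially"
    by (rule filterlim_at_top_mono[OF filterlim_real_sequentially])
      (simp add: x(1) less_imp_le)
  \<comment> \<open>Pairing \<open>(0, -1)\<close> with \<open>(w, \<rho>)\<close> gives
    \<open>- \<rho>\<close>, so only the sign of \<rho> matters.\<close>
  have "0 \<le> \<rho>" if "(w, \<rho>) \<in> tangent_cone_inf (epi \<phi>)" for w \<rho>
  proof -
    have "(x k, r k) \<in> epi \<phi>" for k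
      using x(2) by (simp add: epi_def)
    with that x_lim t_pos t_lim obtain w' \<rho>'
      where lim: "(\<lambda>k. (w' k, \<rho>' k)) \<longlonglongrightarrow> (w, \<rho>)"
        and mem: "\<And>k. (x k, r k) + t k *\<^sub>R (w' k, \<rho>' k) \<in> epi \<phi>"
      unfolding tangent_cone_inf_def by blast
    have "- t k \<le> \<rho>' k" for k
    proof -
      have "\<phi> (x k + t k *\<^sub>R w' k) \<le> ereal (r k + t k * \<rho>' k)"
        using mem[of k] by (simp add: epi_def)
      with lower have "ereal m \<le> ereal (r k + t k * \<rho>' k)"
        by (rule order_trans)
      then have "0 \<le> t k * (t k + \<rho>' k)"
        by (simp add: r_def power2_eq_square distrib_left)
      then show ?thesis
        using t_pos[of k] by (simp add: zero_le_mult_iff)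
    qed
    moreover have "(\<lambda>k. - t k) \<longlonglongrightarrow> 0"
      using tendsto_minus[OF t_lim] by simp
    moreover have "\<rho>' \<longlonglongrightarrow> \<rho>"
      using tendsto_snd[OF lim] by simp
    ultimately show ?thesis
      by (blast intro: LIMSEQ_le)
  qed
  then show ?thesis
    by (auto simp: subdiff_inf_def normal_cone_inf_def)
qed

theorem theorem5p2:
  fixes f :: "real ^ 'n \<Rightarrow> ereal" and C :: "(real ^ 'n) set"
  assumes "\<And>x. f x \<noteq> -\<infinity>"
    and "proper f"
    and "lower_semicontinuous f"
    and "econvex f"
    and "\<not> bounded (eff_dom f)"
    and "C \<noteq> {}" and "closed C" and "convex C"
    and "\<not> bounded (C \<inter> eff_dom f)"
    and "(INF x\<in>C. f x) > -\<infinity>"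
    and "0 \<notin> subdiff_inf (\<lambda>x. f x + delta C x)"
  shows "\<exists>x \<in> C \<inter> eff_dom f. f x = (INF y\<in>C. f y)"
proof (rule ccontr)
  assume not_attained: "\<not> (\<exists>x \<in> C \<inter> eff_dom f. f x = (INF y\<in>C. f y))"
  obtain x0 where x0: "x0 \<in> C" "f x0 < \<infinity>"
    using assms(9) by (cases "C \<inter> eff_dom f = {}") (auto simp: eff_dom_def)
  have fin: "(INF x\<in>C. f x) < \<infinity>"
    using x0 by (meson INF_lower le_less_trans)
  with assms(10) obtain m where m: "(INF x\<in>C. f x) = ereal m"
    by (cases "INF x\<in>C. f x") auto
  have "0 \<in> subdiff_inf (\<lambda>x. f x + delta C x)"
  proof (rule zero_in_subdiff_infI)
    show "ereal m \<le> f x + delta C x" for x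
      using INF_lower[of x C f] assms(1)[of x] by (auto simp: m delta_def)
  next
    fix \<epsilon> :: real
    assume "0 < \<epsilon>"
    \<comment> \<open>Outside \<open>C\<close> the sum is infinite and exceeds every real
      level.\<close>
    have "{x. f x + delta C x \<le> ereal (m + \<epsilon>)} = {x \<in> C. f x \<le> ereal (m + \<epsilon>)}"
      using assms(1) by (auto simp: delta_def split: if_splits)
    moreover have "\<not> bounded {x \<in> C. f x \<le> ereal (m + \<epsilon>)}"
    proof
      assume "bounded {x \<in> C. f x \<le> ereal (m + \<epsilon>)}"
      with assms(3,7) \<open>0 < \<epsilon>\<close> have "\<exists>x\<in>C. f x = (INF y\<in>C. f y)"
        by (intro inf_attained_if_bounded_sublevel[where a = "ereal (m + \<epsilon>)"]) (auto simp: m)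
      \<comment> \<open>The minimizer is only known to lie in \<open>C\<close>; finiteness of the
        infimum places it in \<open>eff_dom f\<close>.\<close>
      with not_attained fin show False
        by (auto simp: eff_dom_def)
    qed
    ultimately show "\<not> bounded {x. f x + delta C x \<le> ereal (m + \<epsilon>)}"
      by simp
  qed
  with assms(11) show False
    by contradiction
qed

end
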